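(* Let $a\in\mathbb Z$, $b\in\{0,1\}$, $x\in\mathbb Z\setminus\{0\}$, $\sigma\in\{1,-1\}$, $r\in\mathbb Q\setminus\{0\}$, and suppose that $$\alpha= r\left(\frac{x+\sqrt{x^2+4\sigma}}{2}\right)^{a}\left(\sqrt{x^2+4\sigma}\right)^{b}$$ is a positive real quadratic irrational number. Then for every $\varepsilon>0$ there is $C>0$ such that $\delta_{\min}^{(\alpha)}(N)\le C N^{-1+\varepsilon}$ for infinitely many integers $N$.
   Context: For irrational $\alpha>0$, the numbers $\alpha m^2+n^2$ with integers $m,n\ge 1$ are pairwise distinct; list them in increasing order as $0<\lambda_1<\lambda_2<\cdots$. For $N\ge 2$ define $\delta_{\min}^{(\alpha)}(N)=\min\{\lambda_{i+1}-\lambda_i : 1\le i<N\}$. *)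

theory Defs
  imports Complex_Main
begin

definition spec_set :: "real \<Rightarrow> real set" where
  "spec_set \<alpha> = {\<alpha> * (real m)^2 + (real n)^2 | m n :: nat. m \<ge> 1 \<and> n \<ge> 1}"

definition lam :: "real \<Rightarrow> nat \<Rightarrow> real" where
  "lam \<alpha> i = (THE y. y \<in> spec_set \<alpha> \<and> card {z \<in> spec_set \<alpha>. z < y} = i - 1)"

definition delta_min :: "real \<Rightarrow> nat \<Rightarrow> real" where
  "delta_min \<alpha> N = Min {lam \<alpha> (i + 1) - lam \<alpha> i | i. 1 \<le> i \<and> i < N}"

end

theory Submission
  imports Defs "HOL-Analysis.Harmonic_Numbers" "HOL-Number_Theory.Cong"
begin

text \<open>
  Let \<open>\<omega> > 1\<close> be the unit \<open>(|x| + sqrt D) / 2\<close>, \<open>D = x\<^sup>2 + 4\<sigma>\<close>, and let \<open>U\<close>, \<open>V\<close> be its Lucas sequences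
  (for \<open>x < 0\<close> the exponent \<open>a\<close> changes sign).
  Up to the rational factor \<open>r = p/q\<close>, the quotients \<open>U (k + a) / U k\<close> (if \<open>b = 0\<close>) and
  \<open>V (k + a) / U k\<close> (if \<open>b = 1\<close>) approximate \<open>\<alpha>\<close> as well as convergents do, so
  \<open>\<alpha> (12 q U k) - 12 p W (k + a) = O(\<omega>\<^bsup>-k\<^esup>)\<close>, with \<open>W\<close> the relevant one of \<open>U\<close>, \<open>V\<close>.
  If both numbers split into two factors of size about \<open>\<omega>\<^bsup>k/2\<^esup>\<close>, they are differences of squares
  \<open>m\<^sup>2 - m'\<^sup>2\<close> and \<open>n\<^sup>2 - n'\<^sup>2\<close> with \<open>m, n\<close> of size about \<open>\<omega>\<^bsup>k/2\<^esup>\<close>, and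
  \<open>\<alpha> m\<^sup>2 + n'\<^sup>2\<close>, \<open>\<alpha> m'\<^sup>2 + n\<^sup>2\<close> are two close elements of the spectrum.
  The factorizations come from strong divisibility \<open>gcd (U m) (U n) = U (gcd m n)\<close> (for \<open>V\<close>: odd indices):
  for a finite set \<open>P\<close> of primes dividing \<open>k\<close>, the lcm of the \<open>U (k/p)\<close>, \<open>p \<in> P\<close>, is a divisor of
  \<open>U k\<close> of size about \<open>\<omega>\<^bsup>k(1-\<pi>)\<^esup>\<close> with \<open>\<pi> = \<Prod>p\<in>P. 1 - 1/p\<close>, and \<open>\<pi>\<close> can be brought arbitrarily
  close to \<open>1/2\<close> since the Euler product over the primes diverges to \<open>0\<close>. Disjoint sets of primes
  for \<open>k\<close> and \<open>k + a\<close> are accommodated by the Chinese remainder theorem.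
\<close>

section \<open>Products over primes\<close>

text \<open>A finite form of the Euler product bound. Splitting off the multiples of a new prime
  \<open>p\<close> shows that admitting \<open>p\<close> enlarges the sum by a factor of at most
  \<open>1 / (1 - 1/p)\<close>; no infinite series is involved.\<close>

lemma euler_product_smooth_bound:
  fixes A :: "nat set" and N :: nat
  assumes "finite A" and "\<And>p. p \<in> A \<Longrightarrow> prime p"
  shows "(\<Prod>p\<in>A. 1 - 1 / real p) * (\<Sum>n | n \<in> {1..N} \<and> prime_factors n \<subseteq> A. 1 / real n) \<le> 1"
  using assms
proof (induction A rule: finite_induct)
  case empty
  have "{n. n \<in> {1..N} \<and> prime_factors n \<subseteq> {}} \<subseteq> {1}"
    by (auto simp: prime_factorization_empty_iff)
  then have "(\<Sum>n | n \<in> {1..N} \<and> prime_factors n \<subseteq> {}. 1 / real n) \<le> (\<Sum>n\<in>{1}. 1 / real n)"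
    by (intro sum_mono2) auto
  then show ?case by simp
next
  case (insert p A)
  define S where "S B = {n. n \<in> {1..N} \<and> prime_factors n \<subseteq> B}" for B
  define T where "T = {n \<in> S (insert p A). p dvd n}"
  have p: "prime p" and p1: "real p > 1"
    using insert.prems prime_gt_1_nat[of p] by auto
  have fin: "finite (S B)" for B
    unfolding S_def by (rule finite_subset[of _ "{1..N}"]) auto
  have "S (insert p A) - T \<subseteq> S A"
    unfolding S_def T_def by (auto dest: in_prime_factors_imp_dvd)
  then have "S (insert p A) \<subseteq> S A \<union> T" by auto
  then have "(\<Sum>n\<in>S (insert p A). 1 / real n) \<le> (\<Sum>n\<in>S A \<union> T. 1 / real n)"
    using fin by (intro sum_mono2) (auto simp: T_def)
  also have "\<dots> \<le> (\<Sum>n\<in>S A. 1 / real n) + (\<Sum>n\<in>T. 1 / real n)"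
    using sum.union_inter[of "S A" T "\<lambda>n. 1 / real n"] fin
      sum_nonneg[of "S A \<inter> T" "\<lambda>n. 1 / real n"] by (simp add: T_def)
  also have "(\<Sum>n\<in>T. 1 / real n) = (\<Sum>k\<in>(\<lambda>n. n div p) ` T. 1 / real p * (1 / real k))"
  proof (rule sum.reindex_cong[where l = "\<lambda>k. p * k"])
    show "inj_on (\<lambda>k. p * k) ((\<lambda>n. n div p) ` T)"
      using p1 by (auto simp: inj_on_def)
    show "T = (\<lambda>k. p * k) ` (\<lambda>n. n div p) ` T"
      by (auto simp: T_def image_image intro!: image_eqI)
  qed auto
  \<comment> \<open>Dividing by \<open>p\<close> stays inside \<open>S (insert p A)\<close>, so the
    sum being bounded reappears with factor \<open>1 / p\<close> and can be absorbed on the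
    left.\<close>
  also have "\<dots> \<le> (\<Sum>k\<in>S (insert p A). 1 / real p * (1 / real k))"
  proof (rule sum_mono2)
    show "(\<lambda>n. n div p) ` T \<subseteq> S (insert p A)"
    proof clarify
      fix n assume n: "n \<in> T"
      then obtain k where k: "n = p * k" by (auto simp: T_def)
      have "k \<noteq> 0" "n \<le> N" "prime_factors n \<subseteq> insert p A"
        using n k by (auto simp: T_def S_def)
      moreover have "prime_factors k \<subseteq> prime_factors n"
        using k \<open>k \<noteq> 0\<close> p1 by (intro dvd_prime_factors) auto
      moreover have "k \<le> N"
        using k p1 \<open>n \<le> N\<close>
        by (metis dvd_imp_le dvd_triv_right \<open>k \<noteq> 0\<close> gr0I le_trans mult_eq_0_iff
            of_nat_0 not_one_less_zero)
      ultimately show "n div p \<in> S (insert p A)"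
        using k p1 by (auto simp: S_def)
    qed
  qed (use fin in auto)
  also have "\<dots> = 1 / real p * (\<Sum>k\<in>S (insert p A). 1 / real k)"
    by (simp add: sum_distrib_left)
  finally have "(1 - 1 / real p) * (\<Sum>n\<in>S (insert p A). 1 / real n) \<le> (\<Sum>n\<in>S A. 1 / real n)"
    by (simp add: left_diff_distrib)
  moreover have "0 \<le> (\<Prod>p\<in>A. 1 - 1 / real p)"
    by (intro prod_nonneg) (auto simp: divide_le_eq_1)
  ultimately have "(\<Prod>p\<in>A. 1 - 1 / real p) * ((1 - 1 / real p) * (\<Sum>n\<in>S (insert p A). 1 / real n))
      \<le> (\<Prod>p\<in>A. 1 - 1 / real p) * (\<Sum>n\<in>S A. 1 / real n)"
    by (rule mult_left_mono)
  also have "\<dots> \<le> 1"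
    using insert.IH insert.prems by (simp add: S_def)
  finally show ?case
    using insert.hyps by (simp add: S_def mult_ac)
qed

text \<open>Every \<open>n \<le> N\<close> has only prime factors up to \<open>N\<close>, so the
  smooth sum is the full harmonic sum.\<close>

lemma prod_primes_times_harm_le:
  "(\<Prod>p | prime p \<and> p \<le> N. 1 - 1 / real p) * harm N \<le> 1"
proof -
  have fin: "finite {p::nat. prime p \<and> p \<le> N}" by (rule finite_subset[of _ "{..N}"]) auto
  have "{n. n \<in> {1..N} \<and> prime_factors n \<subseteq> {p. prime p \<and> p \<le> N}} = {1..N}"
    by (auto simp: in_prime_factors_iff dest!: dvd_imp_le)
  with euler_product_smooth_bound[OF fin, of N] show ?thesis
    by (simp add: harm_def inverse_eq_divide)
qed

text \<open>The primes up to \<open>M\<close> contribute only a fixed positive factor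
  \<open>c\<close>, so divergence of the harmonic sum still forces the remaining product down. The
  freedom in \<open>M\<close> later makes two prime sets disjoint and odd.\<close>

lemma ex_primes_prod_le_half:
  "\<exists>N. (\<Prod>p | prime p \<and> M < p \<and> p \<le> N. 1 - 1 / real p) \<le> 1 / 2"
proof -
  define c where "c = (\<Prod>p | prime p \<and> p \<le> M. 1 - 1 / real p)"
  have pos: "1 - 1 / real p > 0" if "prime p" for p
    using prime_gt_1_nat[OF that] by simp
  have c: "c > 0" unfolding c_def by (intro prod_pos) (use pos in auto)
  have "eventually (\<lambda>N. harm N \<ge> 2 / c) sequentially"
    using harm_at_top by (simp add: filterlim_at_top)
  then obtain N where N: "N \<ge> M" "harm N \<ge> 2 / c"
    by (metis eventually_sequentially le_cases)
  define R where "R = (\<Prod>p | prime p \<and> M < p \<and> p \<le> N. 1 - 1 / real p)"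
  have "R \<ge> 0" unfolding R_def by (intro prod_nonneg) (use pos in \<open>auto intro: less_imp_le\<close>)
  have fin: "finite {p::nat. prime p \<and> p \<le> N}" for N by (rule finite_subset[of _ "{..N}"]) auto
  have "{p. prime p \<and> p \<le> N} = {p. prime p \<and> p \<le> M} \<union> {p. prime p \<and> M < p \<and> p \<le> N}"
    using N(1) by auto
  then have "(\<Prod>p | prime p \<and> p \<le> N. 1 - 1 / real p) = c * R"
    unfolding c_def R_def using fin
    by (simp only:) (intro prod.union_disjoint, auto intro: finite_subset[OF _ fin[of N]])
  then have "c * R * harm N \<le> 1"
    using prod_primes_times_harm_le[of N] by simp
  moreover have "c * R * (2 / c) \<le> c * R * harm N"
    using N(2) c \<open>R \<ge> 0\<close> by (intro mult_left_mono) auto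
  ultimately have "R \<le> 1 / 2" using c by simp
  then show ?thesis unfolding R_def by blast
qed

text \<open>Stop at the first \<open>N\<close> where the product drops to \<open>1/2\<close>.
  Minimality makes \<open>N\<close> a prime of the range, and the last factor \<open>1 - 1/N\<close>
  is too close to 1 to overshoot by more than \<open>\<eta>\<close>.\<close>

lemma ex_primes_prod_near_half:
  fixes \<eta> :: real
  assumes "\<eta> > 0"
  shows "\<exists>P. finite P \<and> (\<forall>p\<in>P. prime p \<and> M < p) \<and>
    (\<Prod>p\<in>P. 1 - 1 / real p) \<le> 1 / 2 \<and> 1 / 2 - \<eta> \<le> (\<Prod>p\<in>P. 1 - 1 / real p)"
proof -
  obtain K :: nat where K: "1 / \<eta> < real K" using reals_Archimedean2 by blast
  \<comment> \<open>Starting above \<open>1 / \<eta>\<close> as well makes every single factor at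
    least \<open>1 - \<eta>\<close>.\<close>
  define M' where "M' = max M K"
  have M': "M' \<ge> M" "real M' \<ge> 1 / \<eta>" using K by (auto simp: M'_def)
  let ?S = "\<lambda>N. {p. prime p \<and> M' < p \<and> p \<le> N}"
  let ?f = "\<lambda>N. \<Prod>p\<in>?S N. 1 - 1 / real p"
  define N where "N = (LEAST N. ?f N \<le> 1 / 2)"
  have le: "?f N \<le> 1 / 2"
    unfolding N_def by (rule LeastI_ex) (rule ex_primes_prod_le_half)
  have "N \<noteq> 0" using le by (intro notI) simp
  then obtain L where L: "N = Suc L" by (cases N) auto
  have gt: "?f L > 1 / 2"
    using not_less_Least[of L "\<lambda>N. ?f N \<le> 1 / 2"] L unfolding N_def by simp
  have fin: "finite (?S K)" for K by (rule finite_subset[of _ "{..K}"]) auto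
  have N: "prime N" "M' < N"
  proof -
    have "prime N \<and> M' < N"
    proof (rule ccontr)
      assume "\<not> ?thesis"
      then have "?S N = ?S L" by (auto simp: L le_Suc_eq)
      with le gt show False by simp
    qed
    then show "prime N" "M' < N" by auto
  qed
  have "?S N = insert N (?S L)" using N by (auto simp: L)
  moreover have "N \<notin> ?S L" by (simp add: L)
  ultimately have "?f N = (1 - 1 / real N) * ?f L"
    using fin[of L] by simp
  moreover have "(1 - 1 / real N) * (1 / 2) \<le> (1 - 1 / real N) * ?f L"
    using gt N(2) by (intro mult_left_mono) auto
  moreover have "1 / real N \<le> \<eta>"
  proof -
    have "1 / \<eta> \<le> real N" using M'(2) N(2) by linarith
    then show ?thesis using assms N(2) by (simp add: field_simps)
  qed
  ultimately have "?f N \<ge> 1 / 2 - \<eta>"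
    using assms by (simp add: algebra_simps)
  with le fin[of N] M'(1) show ?thesis
    by (intro exI[of _ "?S N"]) auto
qed

section \<open>Balanced factorizations in strong divisibility sequences\<close>

lemma gcd_Lcm_image_nat:
  fixes f :: "'a \<Rightarrow> nat"
  assumes "finite P"
  shows "gcd a (Lcm (f ` P)) = Lcm ((\<lambda>p. gcd a (f p)) ` P)"
  using assms by induction (simp_all add: gcd_lcm_distrib)

text \<open>Combined with strong divisibility, this turns
  \<open>gcd (W (n div q)) (W (n div p))\<close> into a term of the lcm belonging to the index
  \<open>n div q\<close>.\<close>

lemma gcd_div_distinct_primes:
  fixes p q n :: nat
  assumes "prime p" "prime q" "p \<noteq> q" "p dvd n" "q dvd n"
  shows "gcd (n div q) (n div p) = n div q div p"
proof -
  have "coprime p q" using assms by (simp add: primes_coprime)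
  then have "p * q dvd n" using assms by (simp add: divides_mult)
  then obtain k where k: "n = p * q * k" by blast
  have "gcd (p * k) (q * k) = k"
    using \<open>coprime p q\<close> by (simp add: gcd_mult_right mult.commute[of _ k] flip: gcd_mult_distrib_nat)
  then show ?thesis
    using k prime_gt_0_nat[OF assms(1)] prime_gt_0_nat[OF assms(2)]
    by (simp add: mult.commute mult.left_commute)
qed

text \<open>The predicate \<open>J\<close> restricts the indices because the gcd law for
  \<open>V\<close> can fail at even ones. Closure under divisors keeps the indices
  \<open>n div p\<close> admissible.\<close>

locale strong_divisibility_growth =
  fixes W :: "nat \<Rightarrow> nat" and J :: "nat \<Rightarrow> bool" and g c C :: real
  assumes g: "g > 1" and c: "c > 0" and C: "C > 0"
    and lower: "\<And>n. J n \<Longrightarrow> n \<ge> 1 \<Longrightarrow> c * g ^ n \<le> real (W n)"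
    and upper: "\<And>n. J n \<Longrightarrow> n \<ge> 1 \<Longrightarrow> real (W n) \<le> C * g ^ n"
    and J: "\<And>d n. J n \<Longrightarrow> d dvd n \<Longrightarrow> J d"
    and sd: "\<And>m n. J m \<Longrightarrow> J n \<Longrightarrow> gcd (W m) (W n) = W (gcd m n)"
begin

text \<open>Strong divisibility turns \<open>gcd (W (n div q)) (LCM p\<in>P. W (n div p))\<close> into the same lcm
  for \<open>n div q\<close>; this gives the recursion behind the induction on \<open>P\<close>.\<close>

lemma Lcm_growth:
  fixes P :: "nat set"
  assumes P: "finite P" "\<And>p. p \<in> P \<Longrightarrow> prime p"
  shows "\<exists>c'>0. \<exists>C'>0. \<forall>n\<ge>1. J n \<longrightarrow> \<Prod>P dvd n \<longrightarrow>
    c' * g powr (real n * (1 - (\<Prod>p\<in>P. 1 - 1 / real p))) \<le> real (LCM p\<in>P. W (n div p)) \<and>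
    real (LCM p\<in>P. W (n div p)) \<le> C' * g powr (real n * (1 - (\<Prod>p\<in>P. 1 - 1 / real p)))"
  using P
proof (induction P rule: finite_induct)
  case empty
  show ?case using g by (intro exI[of _ 1] conjI) auto
next
  case (insert q P)
  define \<pi> where "\<pi> = (\<Prod>p\<in>P. 1 - 1 / real p)"
  define L where "L n = (LCM p\<in>P. W (n div p))" for n
  obtain c' C' where c': "c' > 0" and C': "C' > 0"
    and IH: "\<And>n. n \<ge> 1 \<Longrightarrow> J n \<Longrightarrow> \<Prod>P dvd n \<Longrightarrow>
      c' * g powr (real n * (1 - \<pi>)) \<le> real (L n) \<and> real (L n) \<le> C' * g powr (real n * (1 - \<pi>))"
    using insert.IH insert.prems unfolding \<pi>_def[symmetric] L_def[symmetric] by blast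
  have q: "prime q" and q0: "q > 0" using insert.prems prime_gt_0_nat by auto
  have prod: "(\<Prod>p\<in>insert q P. 1 - 1 / real p) = (1 - 1 / real q) * \<pi>"
    unfolding \<pi>_def using insert.hyps by simp
  \<comment> \<open>With \<open>m = n div q\<close> the new lcm equals
    \<open>W m * L n / L m\<close>; each constant combines bounds for the numerator with the
    opposite bound for the denominator.\<close>
  have "c * c' / C' * g powr (real n * (1 - (1 - 1 / real q) * \<pi>)) \<le> real (LCM p\<in>insert q P. W (n div p))
    \<and> real (LCM p\<in>insert q P. W (n div p)) \<le> C * C' / c' * g powr (real n * (1 - (1 - 1 / real q) * \<pi>))"
    if n: "n \<ge> 1" "J n" "\<Prod>(insert q P) dvd n" for n
  proof -
    define m where "m = n div q"
    have dvd: "q * \<Prod>P dvd n" using n(3) insert.hyps by simp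
    then have qn: "q dvd n" and nm: "n = q * m" by (auto simp: m_def)
    have m: "m \<ge> 1" "J m" "\<Prod>P dvd m"
      using n nm q0 dvd J by auto
    have Pn: "\<Prod>P dvd n" using dvd by auto
    have "gcd (W m) (W (n div p)) = W (m div p)" if p: "p \<in> P" for p
    proof -
      have "p dvd n" using p Pn insert.hyps dvd_prodI[of P p "\<lambda>x. x"] dvd_trans by blast
      moreover have "J (n div p)" using J[OF n(2)] \<open>p dvd n\<close> by auto
      ultimately show ?thesis
        using sd[OF m(2)] gcd_div_distinct_primes[of p q n] p q qn insert.hyps insert.prems
        by (metis insertCI m_def)
    qed
    then have G: "gcd (W m) (L n) = L m"
      unfolding L_def by (simp add: gcd_Lcm_image_nat[OF insert.hyps(1)] image_image cong: image_cong)
    have "real (L m) > 0"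
      using IH[OF m] c' g by (smt (verit) mult_pos_pos powr_gt_zero)
    moreover have "lcm (W m) (L n) * L m = W m * L n"
      using prod_gcd_lcm_nat[of "W m" "L n"] G by (simp add: mult.commute)
    then have "real (lcm (W m) (L n)) * real (L m) = real (W m) * real (L n)"
      by (metis of_nat_mult)
    ultimately have eq: "real (LCM p\<in>insert q P. W (n div p)) = real (W m) * real (L n) / real (L m)"
      by (simp add: L_def m_def field_simps)
    \<comment> \<open>The exponents of \<open>W m\<close>, \<open>L n\<close> and \<open>L m\<close>
      add up to the claimed one because \<open>n = q * m\<close>.\<close>
    have "real n * (1 - (1 - 1 / real q) * \<pi>) = real m + real n * (1 - \<pi>) - real m * (1 - \<pi>)"
      using q0 by (simp add: nm field_simps)
    then have pw: "g powr (real n * (1 - (1 - 1 / real q) * \<pi>))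
        = g ^ m * g powr (real n * (1 - \<pi>)) / g powr (real m * (1 - \<pi>))"
      using g by (simp add: powr_add powr_diff powr_realpow)
    have gm: "g ^ m > 0" using g by simp
    have "c * c' / C' * g powr (real n * (1 - (1 - 1 / real q) * \<pi>))
        = (c * g ^ m) * (c' * g powr (real n * (1 - \<pi>))) / (C' * g powr (real m * (1 - \<pi>)))"
      unfolding pw by simp
    also have "\<dots> \<le> real (W m) * real (L n) / real (L m)"
      using lower[OF m(2,1)] IH[OF m] IH[OF n(1,2) Pn] \<open>real (L m) > 0\<close> c c' gm
      by (intro frac_le mult_mono) auto
    finally have 1: "c * c' / C' * g powr (real n * (1 - (1 - 1 / real q) * \<pi>))
        \<le> real (W m) * real (L n) / real (L m)" .
    have "real (W m) * real (L n) / real (L m)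
        \<le> (C * g ^ m) * (C' * g powr (real n * (1 - \<pi>))) / (c' * g powr (real m * (1 - \<pi>)))"
      using upper[OF m(2,1)] IH[OF m] IH[OF n(1,2) Pn] \<open>real (L m) > 0\<close> C C' c' gm g
      by (intro frac_le mult_mono) auto
    also have "\<dots> = C * C' / c' * g powr (real n * (1 - (1 - 1 / real q) * \<pi>))"
      unfolding pw by simp
    finally show ?thesis using 1 unfolding eq by blast
  qed
  then show ?case
    unfolding prod using c C c' C'
    by (intro exI[of _ "c * c' / C'"] conjI exI[of _ "C * C' / c'"]) auto
qed

text \<open>The lcm \<open>L n\<close> divides \<open>W n\<close> and has growth exponent
  \<open>1 - \<pi>\<close>, its cofactor has exponent \<open>\<pi>\<close>; for \<open>\<pi>\<close>
  within \<open>\<eta>\<close> below \<open>1/2\<close> neither exceeds \<open>1/2 + \<eta>\<close>.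
  The constant depends on \<open>P\<close> but not on \<open>n\<close>.\<close>

lemma balanced_factorization:
  fixes \<eta> :: real and P :: "nat set"
  assumes P: "finite P" "\<And>p. p \<in> P \<Longrightarrow> prime p"
    and half: "(\<Prod>p\<in>P. 1 - 1 / real p) \<le> 1 / 2" "1 / 2 - \<eta> \<le> (\<Prod>p\<in>P. 1 - 1 / real p)"
    and \<eta>: "\<eta> \<ge> 0"
  shows "\<exists>K>0. \<forall>n\<ge>1. J n \<longrightarrow> \<Prod>P dvd n \<longrightarrow>
    (\<exists>l l'. l > 0 \<and> l' > 0 \<and> W n = l * l' \<and>
      real l \<le> K * g powr (real n * (1 / 2 + \<eta>)) \<and> real l' \<le> K * g powr (real n * (1 / 2 + \<eta>)))"
proof -
  define \<pi> where "\<pi> = (\<Prod>p\<in>P. 1 - 1 / real p)"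
  define L where "L n = (LCM p\<in>P. W (n div p))" for n
  obtain c' C' where c': "c' > 0" and C': "C' > 0"
    and L: "\<And>n. n \<ge> 1 \<Longrightarrow> J n \<Longrightarrow> \<Prod>P dvd n \<Longrightarrow>
      c' * g powr (real n * (1 - \<pi>)) \<le> real (L n) \<and> real (L n) \<le> C' * g powr (real n * (1 - \<pi>))"
    using Lcm_growth[OF P]
    unfolding \<pi>_def[symmetric] L_def[symmetric] by blast
  \<comment> \<open>\<open>C'\<close> serves the divisor \<open>L n\<close>, and
    \<open>C / c'\<close> serves the cofactor \<open>W n / L n\<close>.\<close>
  define K where "K = max C' (C / c')"
  have "\<exists>l l'. l > 0 \<and> l' > 0 \<and> W n = l * l' \<and>
      real l \<le> K * g powr (real n * (1 / 2 + \<eta>)) \<and> real l' \<le> K * g powr (real n * (1 / 2 + \<eta>))"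
    if n: "n \<ge> 1" "J n" "\<Prod>P dvd n" for n
  proof -
    have "W (n div p) dvd W n" if p: "p \<in> P" for p
    proof -
      have "n div p dvd n"
        using p n(3) P dvd_prodI[of P p "\<lambda>x. x"] dvd_trans by (metis dvd_div_mult_self dvd_triv_left)
      then show ?thesis
        using sd[of "n div p" n] J n(2) by (metis gcd_dvd2 gcd_nat.absorb1)
    qed
    then have "L n dvd W n" unfolding L_def by (auto intro: Lcm_least)
    then obtain l' where l': "W n = L n * l'" by blast
    have "W n > 0" using lower[OF n(2,1)] c g
      by (metis gr0I of_nat_0 not_less mult_pos_pos zero_less_power less_trans zero_less_one)
    then have pos: "L n > 0" "l' > 0" using l' by auto
    have mono: "a * g powr (real n * t) \<le> K * g powr (real n * (1 / 2 + \<eta>))"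
      if "a \<le> K" "t \<le> 1 / 2 + \<eta>" for a t
      using that g C' by (intro mult_mono powr_mono mult_left_mono) (auto simp: K_def)
    have "real (L n) \<le> K * g powr (real n * (1 / 2 + \<eta>))"
      using L[OF n] mono[of C' "1 - \<pi>"] half by (simp add: K_def \<pi>_def)
    moreover have "real l' \<le> K * g powr (real n * (1 / 2 + \<eta>))"
    proof -
      have "real l' = real (W n) / real (L n)" using l' pos by simp
      also have "\<dots> \<le> C * g ^ n / (c' * g powr (real n * (1 - \<pi>)))"
        using upper[OF n(2,1)] L[OF n] c' C g by (intro frac_le) auto
      also have "\<dots> = C / c' * (g powr real n / g powr (real n * (1 - \<pi>)))"
        using g by (simp add: powr_realpow)
      also have "g powr real n / g powr (real n * (1 - \<pi>)) = g powr (real n * \<pi>)"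
        by (simp add: powr_diff[symmetric] algebra_simps)
      also have "C / c' * g powr (real n * \<pi>) \<le> K * g powr (real n * (1 / 2 + \<eta>))"
        using half \<eta> by (intro mono) (auto simp: K_def \<pi>_def)
      finally show ?thesis .
    qed
    ultimately show ?thesis using l' pos by blast
  qed
  moreover have "K > 0" using C' by (simp add: K_def)
  ultimately show ?thesis by blast
qed

end

section \<open>Lucas sequences\<close>

text \<open>In the classical notation with parameters P, Q this is the case P = \<open>x\<close>, Q
  = \<open>- s\<close>; \<open>x = s = 1\<close> gives the Fibonacci numbers, and
  \<open>lucas_V\<close> then gives the Lucas numbers.\<close>

fun lucas_U :: "int \<Rightarrow> int \<Rightarrow> nat \<Rightarrow> int" where
  "lucas_U x s 0 = 0"
| "lucas_U x s (Suc 0) = 1"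
| "lucas_U x s (Suc (Suc n)) = x * lucas_U x s (Suc n) + s * lucas_U x s n"

fun lucas_V :: "int \<Rightarrow> int \<Rightarrow> nat \<Rightarrow> int" where
  "lucas_V x s 0 = 2"
| "lucas_V x s (Suc 0) = x"
| "lucas_V x s (Suc (Suc n)) = x * lucas_V x s (Suc n) + s * lucas_V x s n"

text \<open>Modulo \<open>lucas_U x s (Suc n)\<close> only the last summand survives, which is the
  Euclidean step for the gcd law.\<close>

lemma lucas_U_add:
  "lucas_U x s (Suc (m + n)) = lucas_U x s (Suc m) * lucas_U x s (Suc n) + s * lucas_U x s m * lucas_U x s n"
proof (induction n rule: induct_nat_012)
  case (ge2 n)
  have "lucas_U x s (Suc (m + Suc (Suc n))) = x * lucas_U x s (Suc (m + Suc n)) + s * lucas_U x s (Suc (m + n))"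
    by simp
  also have "\<dots> = lucas_U x s (Suc m) * lucas_U x s (Suc (Suc (Suc n)))
      + s * lucas_U x s m * lucas_U x s (Suc (Suc n))"
    unfolding ge2 by (simp add: algebra_simps)
  finally show ?case .
qed (simp_all add: algebra_simps)

text \<open>As \<open>s\<close> is a unit, a common divisor of two consecutive terms descends to the
  preceding pair.\<close>

lemma coprime_lucas_U_Suc:
  assumes "s \<in> {1, -1}"
  shows "coprime (lucas_U x s n) (lucas_U x s (Suc n))"
proof (induction n)
  case (Suc n)
  show ?case
  proof (rule coprimeI)
    fix d assume d: "d dvd lucas_U x s (Suc n)" "d dvd lucas_U x s (Suc (Suc n))"
    then have "d dvd s * lucas_U x s n"
      by (metis dvd_add_right_iff dvd_mult lucas_U.simps(3))
    then have "d dvd lucas_U x s n" using assms by auto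
    with d Suc show "is_unit d" by (meson coprime_def)
  qed
qed simp

text \<open>The subtractive Euclidean algorithm on the indices. Nonnegativity enters because an
  integer gcd is never negative.\<close>

lemma gcd_lucas_U:
  assumes s: "s \<in> {1, -1}" and nonneg: "\<And>n. lucas_U x s n \<ge> 0"
  shows "gcd (lucas_U x s m) (lucas_U x s n) = lucas_U x s (gcd m n)"
proof -
  have step: "gcd (lucas_U x s (m + n)) (lucas_U x s n) = gcd (lucas_U x s m) (lucas_U x s n)" for m n
  proof (cases n)
    case (Suc k)
    have "gcd (lucas_U x s (m + n)) (lucas_U x s n) = gcd (s * lucas_U x s m * lucas_U x s k) (lucas_U x s n)"
      by (simp add: Suc lucas_U_add gcd.commute[of _ "lucas_U x s (Suc k)"] gcd_add_mult)
    also have "\<dots> = gcd (lucas_U x s m * lucas_U x s k) (lucas_U x s n)"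
      using s by auto
    also have "\<dots> = gcd (lucas_U x s m) (lucas_U x s n)"
      using coprime_lucas_U_Suc[OF s, of x k] Suc by (simp add: gcd_mult_left_right_cancel coprime_commute)
    finally show ?thesis .
  qed simp
  show ?thesis
  proof (induction "m + n" arbitrary: m n rule: less_induct)
    case less
    consider "m = 0" | "n = 0" | "m > 0" "n > 0" "n \<le> m" | "m > 0" "n > 0" "m < n" by linarith
    then show ?case
    proof cases
      case 3
      then have "gcd (lucas_U x s m) (lucas_U x s n) = gcd (lucas_U x s (m - n)) (lucas_U x s n)"
        using step[of "m - n" n] by simp
      with 3 less[of "m - n" n] show ?thesis by (simp add: gcd_diff1_nat)
    next
      case 4
      then have "gcd (lucas_U x s m) (lucas_U x s n) = gcd (lucas_U x s (n - m)) (lucas_U x s m)"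
        using step[of "n - m" m] by (simp add: gcd.commute)
      also have "\<dots> = lucas_U x s (gcd (n - m) m)" using 4 by (intro less) simp
      finally show ?thesis using 4 by (simp add: gcd_diff1_nat gcd.commute[of m n])
    qed (use nonneg in auto)
  qed
qed

text \<open>\<open>\<omega>\<close> and \<open>\<omega>'\<close> are the roots of
  \<open>t^2 - x t - s\<close>; the product being a unit makes \<open>\<omega>'\<close> as small as
  \<open>1 / \<omega>\<close> in absolute value.\<close>

locale lucas =
  fixes x s :: int and \<omega> \<omega>' :: real
  assumes s: "s \<in> {1, -1}" and sum: "\<omega> + \<omega>' = real_of_int x"
    and prod: "\<omega> * \<omega>' = - real_of_int s" and gt1: "\<omega> > 1"
begin

abbreviation U :: "nat \<Rightarrow> int" where "U \<equiv> lucas_U x s"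
abbreviation V :: "nat \<Rightarrow> int" where "V \<equiv> lucas_V x s"

lemma x_eq: "real_of_int x = \<omega> + \<omega>'" and s_eq: "real_of_int s = - (\<omega> * \<omega>')"
  using sum prod by auto

lemma U_binet: "(\<omega> - \<omega>') * real_of_int (U n) = \<omega> ^ n - \<omega>' ^ n"
proof (induction n rule: induct_nat_012)
  case (ge2 n)
  have "(\<omega> - \<omega>') * real_of_int (U (Suc (Suc n)))
      = x * ((\<omega> - \<omega>') * real_of_int (U (Suc n))) + s * ((\<omega> - \<omega>') * real_of_int (U n))"
    by (simp add: algebra_simps)
  then show ?case
    unfolding ge2 x_eq s_eq by (simp add: algebra_simps)
qed auto

lemma V_binet: "real_of_int (V n) = \<omega> ^ n + \<omega>' ^ n"
proof (induction n rule: induct_nat_012)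
  case (ge2 n)
  then show ?case
    by (simp add: x_eq s_eq algebra_simps)
qed (auto simp: x_eq)

text \<open>Shows that \<open>V (2 * j + d)\<close> is \<open>V d\<close> up to sign modulo both
  \<open>V j\<close> and \<open>V (j + d)\<close>. The index moves by an even amount, so parity is
  preserved.\<close>

lemma V_mult: "V (j + d) * V j = V (2 * j + d) + (- s) ^ j * V d"
proof -
  have "real_of_int (V (j + d) * V j) = real_of_int (V (2 * j + d) + (- s) ^ j * V d)"
    by (simp add: V_binet s_eq power_mult_distrib power_add power_mult power2_eq_square algebra_simps)
  then show ?thesis by (simp only: of_int_eq_iff)
qed

lemma abs_conj: "\<bar>\<omega>'\<bar> = 1 / \<omega>"
proof -
  have "\<bar>\<omega>\<bar> * \<bar>\<omega>'\<bar> = 1" using prod s by (auto simp flip: abs_mult)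
  then show ?thesis using gt1 by (simp add: field_simps)
qed

lemma abs_conj_power: "\<bar>\<omega>' ^ n\<bar> = 1 / \<omega> ^ n"
  by (simp add: power_abs abs_conj power_one_over)

lemma diff_pos: "\<omega> - \<omega>' > 0"
proof -
  have "1 / \<omega> < 1" using gt1 by simp
  then show ?thesis using abs_conj gt1 by linarith
qed

text \<open>For \<open>n \<ge> 1\<close> the conjugate term is at most a fixed fraction, below one,
  of the dominant term, so lower bounds survive whatever its sign.\<close>

lemma abs_conj_power_le:
  assumes "n \<ge> 1"
  shows "\<bar>\<omega>' ^ n\<bar> \<le> 1 / \<omega>\<^sup>2 * \<omega> ^ n" and "\<bar>\<omega>' ^ n\<bar> \<le> \<omega> ^ n"
proof -
  have "\<omega> ^ 1 * \<omega> ^ 1 \<le> \<omega> ^ n * \<omega> ^ n"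
    using gt1 assms by (intro mult_mono power_increasing) auto
  then have "1 / \<omega> ^ n \<le> 1 / \<omega>\<^sup>2 * \<omega> ^ n"
    using gt1 by (simp add: field_simps power2_eq_square)
  then show 1: "\<bar>\<omega>' ^ n\<bar> \<le> 1 / \<omega>\<^sup>2 * \<omega> ^ n" by (simp add: abs_conj_power)
  have "1 / \<omega>\<^sup>2 \<le> 1" using gt1 by simp
  then have "1 / \<omega>\<^sup>2 * \<omega> ^ n \<le> 1 * \<omega> ^ n" using gt1 by (intro mult_right_mono) auto
  with 1 show "\<bar>\<omega>' ^ n\<bar> \<le> \<omega> ^ n" by simp
qed

lemma one_minus_pos: "1 - 1 / \<omega>\<^sup>2 > 0"
  using gt1 by simp

lemma V_bounds:
  assumes "n \<ge> 1"
  shows "(1 - 1 / \<omega>\<^sup>2) * \<omega> ^ n \<le> real_of_int (V n)" and "real_of_int (V n) \<le> 2 * \<omega> ^ n"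
  using abs_conj_power_le[OF assms] unfolding V_binet left_diff_distrib by linarith+

lemma U_bounds:
  assumes "n \<ge> 1"
  shows "(1 - 1 / \<omega>\<^sup>2) / (\<omega> - \<omega>') * \<omega> ^ n \<le> real_of_int (U n)"
    and "real_of_int (U n) \<le> 2 / (\<omega> - \<omega>') * \<omega> ^ n"
proof -
  have U: "real_of_int (U n) = (\<omega> ^ n - \<omega>' ^ n) / (\<omega> - \<omega>')"
    using U_binet[of n] diff_pos by (simp add: field_simps)
  have "(1 - 1 / \<omega>\<^sup>2) * \<omega> ^ n \<le> \<omega> ^ n - \<omega>' ^ n" "\<omega> ^ n - \<omega>' ^ n \<le> 2 * \<omega> ^ n"
    using abs_conj_power_le[OF assms] unfolding left_diff_distrib by linarith+
  then have "(1 - 1 / \<omega>\<^sup>2) * \<omega> ^ n / (\<omega> - \<omega>') \<le> real_of_int (U n)"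
    "real_of_int (U n) \<le> 2 * \<omega> ^ n / (\<omega> - \<omega>')"
    unfolding U using diff_pos by (auto intro!: divide_right_mono)
  then show "(1 - 1 / \<omega>\<^sup>2) / (\<omega> - \<omega>') * \<omega> ^ n \<le> real_of_int (U n)"
    "real_of_int (U n) \<le> 2 / (\<omega> - \<omega>') * \<omega> ^ n" by auto
qed

lemma V_pos: "n \<ge> 1 \<Longrightarrow> V n > 0"
proof -
  assume n: "n \<ge> 1"
  have "0 < (1 - 1 / \<omega>\<^sup>2) * \<omega> ^ n" using one_minus_pos gt1 by simp
  also have "\<dots> \<le> real_of_int (V n)" using V_bounds[OF n] by simp
  finally show ?thesis by simp
qed

lemma U_nonneg: "U n \<ge> 0"
proof (cases "n = 0")
  case False
  have "0 \<le> (1 - 1 / \<omega>\<^sup>2) / (\<omega> - \<omega>') * \<omega> ^ n" using one_minus_pos diff_pos gt1 by simp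
  also have "\<dots> \<le> real_of_int (U n)" using U_bounds[of n] False by simp
  finally show ?thesis by simp
qed simp

text \<open>A Euclidean algorithm with even steps: the larger index \<open>a\<close> is replaced by
  the distance from \<open>a\<close> to \<open>2 * b\<close>, which is again odd and has the same
  gcd with \<open>b\<close>.\<close>

lemma gcd_V_odd:
  assumes "odd m" "odd n"
  shows "gcd (V m) (V n) = V (gcd m n)"
  using assms
proof (induction "m + n" arbitrary: m n rule: less_induct)
  case less
  have unit: "gcd ((- s) ^ j * a) b = gcd a b" for j and a b :: int
  proof -
    have "(- s) ^ j \<in> {1, -1}" using s by (induction j) auto
    then show ?thesis by auto
  qed
  have step: "gcd (V a) (V b) = V (gcd a b)"
    if "b < a" "odd a" "odd b" "a + b = m + n" for a b
  proof (cases "2 * b \<le> a")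
    case True
    define d where "d = a - 2 * b"
    have a: "a = 2 * b + d" using True by (simp add: d_def)
    have "V a = V (b + d) * V b + - ((- s) ^ b * V d)"
      using V_mult[of b d] by (simp add: a)
    then have "gcd (V a) (V b) = gcd ((- s) ^ b * V d) (V b)"
      by (simp only: gcd.commute[of _ "V b"] gcd_add_mult gcd_neg2)
    also have "\<dots> = gcd (V d) (V b)" by (rule unit)
    also have "\<dots> = V (gcd d b)"
    proof (rule less)
      show "d + b < m + n" using that odd_pos[of b] by (simp add: a)
      show "odd d" "odd b" using that by (auto simp: a)
    qed
    also have "gcd d b = gcd a b" unfolding a gcd.commute[of _ b] by (simp only: gcd_add_mult)
    finally show ?thesis .
  next
    case False
    \<comment> \<open>Here \<open>2 * b\<close> exceeds \<open>a\<close>, so the modulus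
      \<open>V b\<close> takes the place of \<open>V (j + d)\<close> in the product formula instead
      of \<open>V j\<close>.\<close>
    define j d where "j = a - b" and "d = 2 * b - a"
    have b: "b = j + d" and a: "a = 2 * j + d" using False that by (auto simp: j_def d_def)
    have "V a = V j * V b + - ((- s) ^ j * V d)"
      using V_mult[of j d] by (simp add: a b mult.commute)
    then have "gcd (V a) (V b) = gcd ((- s) ^ j * V d) (V b)"
      by (simp only: gcd.commute[of _ "V b"] gcd_add_mult gcd_neg2)
    also have "\<dots> = gcd (V d) (V b)" by (rule unit)
    also have "\<dots> = V (gcd d b)"
    proof (rule less)
      show "d + b < m + n" using that by (simp add: a b)
      show "odd d" "odd b" using that by (auto simp: a)
    qed
    also have "gcd d b = gcd a b"
    proof -
      have "a = j + b" by (simp add: a b)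
      then have "gcd a b = gcd (j + b) b" by simp
      also have "\<dots> = gcd j (j + d)" by (simp only: gcd_add1 b)
      also have "\<dots> = gcd d (j + d)" by (metis gcd.commute gcd_add2 add.commute)
      finally show ?thesis by (simp add: b)
    qed
    finally show ?thesis .
  qed
  consider "m = n" | "n < m" | "m < n" by linarith
  then show ?case
  proof cases
    case 1
    then show ?thesis using V_pos[of n] odd_pos[of n] less.prems by simp
  next
    case 2
    then show ?thesis using step less.prems by simp
  next
    case 3
    then show ?thesis using step[of m n] less.prems by (simp add: gcd.commute)
  qed
qed

section \<open>Rational approximation by quotients of Lucas sequences\<close>

lemma powi_factor:
  fixes a :: int
  assumes "int k' = int k + a"
  shows "\<omega> ^ k' = \<omega> powi a * \<omega> ^ k"
  using assms gt1 power_int_add[of \<omega> a "int k"] by (simp add: add.commute flip: power_int_of_nat)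

text \<open>These are the two terms left over once the dominant powers cancel; both decay like
  \<open>1 / \<omega> ^ k\<close>, with a constant depending only on \<open>a\<close>, which may be
  negative.\<close>

lemma powi_conj_bound:
  fixes a :: int
  assumes "int k' = int k + a"
  shows "\<bar>\<omega>' ^ k'\<bar> + \<bar>\<omega> powi a * \<omega>' ^ k\<bar> = (\<omega> powi a + \<omega> powi (- a)) * (1 / \<omega> ^ k)"
  using powi_factor[OF assms] gt1
  by (simp add: abs_mult abs_conj_power power_int_minus power_int_abs field_simps)

lemma U_approx:
  fixes a :: int
  assumes "int k' = int k + a"
  shows "\<bar>real_of_int (U k') - \<omega> powi a * real_of_int (U k)\<bar>
    \<le> (\<omega> powi a + \<omega> powi (- a)) / (\<omega> - \<omega>') * (1 / \<omega> ^ k)"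
proof -
  have "(\<omega> - \<omega>') * (real_of_int (U k') - \<omega> powi a * real_of_int (U k))
      = (\<omega> - \<omega>') * real_of_int (U k') - \<omega> powi a * ((\<omega> - \<omega>') * real_of_int (U k))"
    by (simp add: algebra_simps)
  also have "\<dots> = \<omega> powi a * \<omega>' ^ k - \<omega>' ^ k'"
    unfolding U_binet powi_factor[OF assms] by (simp add: algebra_simps)
  finally have "(\<omega> - \<omega>') * \<bar>real_of_int (U k') - \<omega> powi a * real_of_int (U k)\<bar>
      = \<bar>\<omega> powi a * \<omega>' ^ k - \<omega>' ^ k'\<bar>"
    using diff_pos by (metis abs_mult abs_of_pos)
  also have "\<dots> \<le> (\<omega> powi a + \<omega> powi (- a)) * (1 / \<omega> ^ k)"
    using powi_conj_bound[OF assms] by linarith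
  finally show ?thesis using diff_pos gt1
    by (simp add: pos_le_divide_eq mult.commute mult.left_commute)
qed

text \<open>The factor \<open>\<omega> - \<omega>'\<close> is the denominator in the Binet formula
  for \<open>U\<close>; it is the square root of the discriminant and accounts for the case
  \<open>b = 1\<close>.\<close>

lemma V_approx:
  fixes a :: int
  assumes "int k' = int k + a"
  shows "\<bar>real_of_int (V k') - \<omega> powi a * (\<omega> - \<omega>') * real_of_int (U k)\<bar>
    \<le> (\<omega> powi a + \<omega> powi (- a)) * (1 / \<omega> ^ k)"
proof -
  have "real_of_int (V k') - \<omega> powi a * (\<omega> - \<omega>') * real_of_int (U k)
      = \<omega> powi a * \<omega>' ^ k + \<omega>' ^ k'"
    unfolding mult.assoc U_binet V_binet powi_factor[OF assms] by (simp add: algebra_simps)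
  then show ?thesis using powi_conj_bound[OF assms] by linarith
qed

end

section \<open>The ordered spectrum\<close>

text \<open>Admissible pairs lie in a box with sides \<open>sqrt (X / \<alpha>)\<close> and
  \<open>sqrt X\<close>.\<close>

lemma spec_set_le_bound:
  assumes "\<alpha> > 0" "X \<ge> 0"
  shows "finite {y \<in> spec_set \<alpha>. y \<le> X}" and "real (card {y \<in> spec_set \<alpha>. y \<le> X}) \<le> X / sqrt \<alpha>"
proof -
  let ?M = "nat \<lfloor>sqrt (X / \<alpha>)\<rfloor>" and ?N = "nat \<lfloor>sqrt X\<rfloor>"
  let ?f = "\<lambda>(m, n). \<alpha> * (real m)\<^sup>2 + (real n)\<^sup>2"
  have sub: "{y \<in> spec_set \<alpha>. y \<le> X} \<subseteq> ?f ` ({1..?M} \<times> {1..?N})"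
  proof clarify
    fix y assume "y \<in> spec_set \<alpha>" "y \<le> X"
    then obtain m n :: nat where mn: "m \<ge> 1" "n \<ge> 1" and y: "y = \<alpha> * (real m)\<^sup>2 + (real n)\<^sup>2"
      by (auto simp: spec_set_def)
    have "\<alpha> * (real m)\<^sup>2 \<ge> 0" using assms by simp
    then have "(real n)\<^sup>2 \<le> X" "\<alpha> * (real m)\<^sup>2 \<le> X"
      using y \<open>y \<le> X\<close> zero_le_power2[of "real n"] by linarith+
    then have "real n \<le> sqrt X" "real m \<le> sqrt (X / \<alpha>)"
      using assms by (auto intro!: real_le_rsqrt simp: field_simps)
    then have "n \<le> ?N" "m \<le> ?M" by (simp_all add: le_nat_floor)
    with mn have "(m, n) \<in> {1..?M} \<times> {1..?N}" by simp
    then show "y \<in> ?f ` ({1..?M} \<times> {1..?N})" by (rule rev_image_eqI) (simp add: y)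
  qed
  then show "finite {y \<in> spec_set \<alpha>. y \<le> X}" by (rule finite_subset) auto
  have "card {y \<in> spec_set \<alpha>. y \<le> X} \<le> card (?f ` ({1..?M} \<times> {1..?N}))"
    by (intro card_mono sub) auto
  also have "\<dots> \<le> card ({1..?M} \<times> {1..?N})" by (rule card_image_le) auto
  also have "\<dots> = ?M * ?N" by simp
  finally have "real (card {y \<in> spec_set \<alpha>. y \<le> X}) \<le> real ?M * real ?N"
    by (metis of_nat_le_iff of_nat_mult)
  also have "\<dots> \<le> sqrt (X / \<alpha>) * sqrt X"
    using assms by (intro mult_mono) auto
  also have "\<dots> = X / sqrt \<alpha>"
    using assms by (simp add: real_sqrt_divide)
  finally show "real (card {y \<in> spec_set \<alpha>. y \<le> X}) \<le> X / sqrt \<alpha>" .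
qed

lemma finite_spec_set_less:
  assumes "\<alpha> > 0"
  shows "finite {z \<in> spec_set \<alpha>. z < y}"
  using spec_set_le_bound(1)[OF assms, of "max 0 y"] by (rule finite_subset[rotated]) auto

lemma card_spec_set_less_mono:
  assumes "\<alpha> > 0" "y \<in> spec_set \<alpha>" "y < z"
  shows "card {w \<in> spec_set \<alpha>. w < y} < card {w \<in> spec_set \<alpha>. w < z}"
proof (rule psubset_card_mono)
  have "y \<in> {w \<in> spec_set \<alpha>. w < z}" using assms by simp
  moreover have "{w \<in> spec_set \<alpha>. w < y} \<subseteq> {w \<in> spec_set \<alpha>. w < z}"
    using assms by auto
  ultimately show "{w \<in> spec_set \<alpha>. w < y} \<subset> {w \<in> spec_set \<alpha>. w < z}" by blast
qed (rule finite_spec_set_less[OF assms(1)])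

text \<open>Counting smaller elements is strictly increasing on the spectrum, so the description in
  \<open>lam\<close> is unique; the \<open>Suc\<close> reflects numbering from 1.\<close>

lemma lam_card_less:
  assumes "\<alpha> > 0" "y \<in> spec_set \<alpha>"
  shows "lam \<alpha> (Suc (card {z \<in> spec_set \<alpha>. z < y})) = y"
  unfolding lam_def
proof (rule the_equality)
  show "y \<in> spec_set \<alpha> \<and> card {z \<in> spec_set \<alpha>. z < y} = Suc (card {z \<in> spec_set \<alpha>. z < y}) - 1"
    using assms by simp
  fix w assume "w \<in> spec_set \<alpha> \<and> card {z \<in> spec_set \<alpha>. z < w} = Suc (card {z \<in> spec_set \<alpha>. z < y}) - 1"
  then show "w = y"
    using card_spec_set_less_mono[OF assms(1), of w y] card_spec_set_less_mono[OF assms, of w]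
    by (cases w y rule: linorder_cases) auto
qed

text \<open>Any two elements below \<open>X\<close> bound a gap between neighbours, namely between
  \<open>y\<close> and its successor, whose position is at most the number of elements up to
  \<open>X\<close>.\<close>

lemma delta_min_le:
  assumes \<alpha>: "\<alpha> > 0" and y: "y \<in> spec_set \<alpha>" and z: "z \<in> spec_set \<alpha>" and "y < z" "z \<le> X"
    and N: "card {w \<in> spec_set \<alpha>. w \<le> X} \<le> N"
  shows "delta_min \<alpha> N \<le> z - y" and "N \<ge> 2"
proof -
  \<comment> \<open>The minimum of \<open>T\<close> is the successor of \<open>y\<close> in the
    spectrum.\<close>
  define T where "T = {w \<in> spec_set \<alpha>. y < w \<and> w \<le> z}"
  define i where "i = Suc (card {w \<in> spec_set \<alpha>. w < y})"
  have fin: "finite {w \<in> spec_set \<alpha>. w \<le> X}"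
    using spec_set_le_bound(1)[OF \<alpha>, of "max 0 X"] by (rule finite_subset[rotated]) auto
  have "finite T" using fin by (rule finite_subset[rotated]) (use \<open>z \<le> X\<close> in \<open>auto simp: T_def\<close>)
  moreover have "z \<in> T" using assms by (simp add: T_def)
  ultimately have t: "Min T \<in> T" and tmin: "\<And>w. w \<in> T \<Longrightarrow> Min T \<le> w"
    by (auto intro: Min_in)
  define t where "t = Min T"
  have t_spec: "t \<in> spec_set \<alpha>" "y < t" "t \<le> z" using t by (auto simp: t_def T_def)
  have "{w \<in> spec_set \<alpha>. w < t} = insert y {w \<in> spec_set \<alpha>. w < y}"
  proof (intro equalityI subsetI)
    fix w assume w: "w \<in> {w \<in> spec_set \<alpha>. w < t}"
    then have "w \<notin> T" using tmin[of w] by (auto simp: t_def)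
    with w t_spec show "w \<in> insert y {w \<in> spec_set \<alpha>. w < y}" by (auto simp: T_def)
  qed (use y t_spec in auto)
  then have ct: "card {w \<in> spec_set \<alpha>. w < t} = i"
    using finite_spec_set_less[OF \<alpha>, of y] by (simp add: i_def)
  have "lam \<alpha> i = y" using lam_card_less[OF \<alpha> y] by (simp add: i_def)
  moreover have "lam \<alpha> (i + 1) = t" using lam_card_less[OF \<alpha> t_spec(1)] ct by simp
  moreover have "i < card {w \<in> spec_set \<alpha>. w \<le> X}"
  proof -
    have "{w \<in> spec_set \<alpha>. w < t} \<subset> {w \<in> spec_set \<alpha>. w \<le> X}"
    proof
      show "{w \<in> spec_set \<alpha>. w < t} \<subseteq> {w \<in> spec_set \<alpha>. w \<le> X}"
        using t_spec \<open>z \<le> X\<close> by auto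
      have "t \<in> {w \<in> spec_set \<alpha>. w \<le> X}" using t_spec \<open>z \<le> X\<close> by simp
      then show "{w \<in> spec_set \<alpha>. w < t} \<noteq> {w \<in> spec_set \<alpha>. w \<le> X}" by blast
    qed
    with fin have "card {w \<in> spec_set \<alpha>. w < t} < card {w \<in> spec_set \<alpha>. w \<le> X}"
      by (rule psubset_card_mono)
    then show ?thesis by (simp add: ct)
  qed
  moreover have "i \<ge> 1" by (simp add: i_def)
  ultimately have iN: "i < N" "i \<ge> 1" and "t - y = lam \<alpha> (i + 1) - lam \<alpha> i"
    using N by auto
  then have "t - y \<in> {lam \<alpha> (i + 1) - lam \<alpha> i | i. 1 \<le> i \<and> i < N}" by blast
  then have "delta_min \<alpha> N \<le> t - y"
    unfolding delta_min_def by (intro Min_le) (simp_all add: setcompr_eq_image)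
  with t_spec show "delta_min \<alpha> N \<le> z - y" by simp
  show "N \<ge> 2" using iN by simp
qed

text \<open>Two complementary splittings \<open>(c l)(3 l')\<close> and \<open>(3 c l) l'\<close> are on offer because the
  smaller square must not vanish.\<close>

lemma diff_squares_factorization:
  fixes c l l' :: nat
  assumes "c > 0" "l > 0" "l' > 0"
  shows "\<exists>m m'. m \<ge> 1 \<and> m' \<ge> 1 \<and> m' \<le> m \<and> (real m)\<^sup>2 - (real m')\<^sup>2 = 12 * real c * real l * real l' \<and>
    m \<le> 3 * c * (l + l')"
proof -
  have key: "\<exists>m m'. m \<ge> 1 \<and> m' \<ge> 1 \<and> m' \<le> m \<and> (real m)\<^sup>2 - (real m')\<^sup>2 = 4 * real u * real v \<and> m = u + v"
    if "u > 0" "u < v" for u v :: nat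
    using that by (intro exI[of _ "u + v"] exI[of _ "v - u"])
      (auto simp: of_nat_diff power2_eq_square algebra_simps)
  have bound: "c * l + 3 * l' \<le> 3 * c * (l + l')" "3 * c * l + l' \<le> 3 * c * (l + l')"
  proof -
    have "l' \<le> c * l'" using assms by simp
    then show "c * l + 3 * l' \<le> 3 * c * (l + l')" "3 * c * l + l' \<le> 3 * c * (l + l')"
      unfolding distrib_left mult.assoc by linarith+
  qed
  \<comment> \<open>If \<open>c * l = 3 * l'\<close>, then \<open>3 * c * l = 9 * l'\<close>, so the
    third case applies.\<close>
  consider "c * l < 3 * l'" | "3 * l' < c * l" | "l' < 3 * c * l"
    using assms by (cases "c * l" "3 * l'" rule: linorder_cases) auto
  then show ?thesis
  proof cases
    case 1
    with key[of "c * l" "3 * l'"] bound assms show ?thesis by (auto simp: algebra_simps)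
  next
    case 2
    with key[of "3 * l'" "c * l"] bound assms show ?thesis by (auto simp: algebra_simps)
  next
    case 3
    with key[of "l'" "3 * c * l"] bound assms show ?thesis by (auto simp: algebra_simps)
  qed
qed

section \<open>Small gaps\<close>

text \<open>The common core of both values of \<open>b\<close>: \<open>W\<close> stands for
  \<open>U\<close> or \<open>V\<close>, and \<open>\<beta>\<close> for \<open>\<alpha>\<close>
  without its rational factor.\<close>

lemma infinitely_many_small_gaps:
  fixes U W :: "nat \<Rightarrow> nat" and g \<alpha> \<beta> K :: real and p q :: nat and a :: int
  assumes U: "strong_divisibility_growth U (\<lambda>_. True) g cU CU"
    and W: "strong_divisibility_growth W odd g cW CW"
    and approx: "\<And>k k'. int k' = int k + a \<Longrightarrow> \<bar>real (W k') - \<beta> * real (U k)\<bar> \<le> K * (1 / g ^ k)"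
    and K: "K > 0" and pq: "p > 0" "q > 0"
    and \<alpha>: "\<alpha> = real p / real q * \<beta>" "\<alpha> > 0" "\<alpha> \<notin> \<rat>"
    and \<epsilon>: "\<epsilon> > 0"
  shows "\<exists>C>0. infinite {N :: nat. N \<ge> 2 \<and> delta_min \<alpha> N \<le> C * real N powr (-1 + \<epsilon>)}"
proof -
  \<comment> \<open>The cap keeps \<open>-1 + \<epsilon>'\<close> negative, so that the power
    decreases in \<open>N\<close>; with \<open>\<eta> = \<epsilon>' / 4\<close> the product
    \<open>(1 + 2 * \<eta>) * (-1 + \<epsilon>')\<close> is still at least
    \<open>-1\<close>.\<close>
  define \<epsilon>' where "\<epsilon>' = min \<epsilon> (1 / 2)"
  define \<eta> where "\<eta> = \<epsilon>' / 4"
  have \<epsilon>': "\<epsilon>' > 0" "\<epsilon>' \<le> \<epsilon>" "\<epsilon>' \<le> 1 / 2" and \<eta>: "\<eta> > 0" using \<epsilon> by (auto simp: \<epsilon>'_def \<eta>_def)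
  have g: "g > 1" using U by (simp add: strong_divisibility_growth_def)
  obtain S where S: "finite S" "\<And>p. p \<in> S \<Longrightarrow> prime p" "\<And>p. p \<in> S \<Longrightarrow> 2 < p"
    "(\<Prod>p\<in>S. 1 - 1 / real p) \<le> 1 / 2" "1 / 2 - \<eta> \<le> (\<Prod>p\<in>S. 1 - 1 / real p)"
    using ex_primes_prod_near_half[OF \<eta>, of 2] by blast
  \<comment> \<open>Choosing \<open>T\<close> above \<open>S\<close> and above 2 makes the two
    products coprime and the product of \<open>T\<close> odd, as odd indices \<open>k'\<close>
    require.\<close>
  obtain T where T: "finite T" "\<And>p. p \<in> T \<Longrightarrow> prime p" "\<And>p. p \<in> T \<Longrightarrow> Max (insert 2 S) < p"
    "(\<Prod>p\<in>T. 1 - 1 / real p) \<le> 1 / 2" "1 / 2 - \<eta> \<le> (\<Prod>p\<in>T. 1 - 1 / real p)"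
    using ex_primes_prod_near_half[OF \<eta>, of "Max (insert 2 S)"] by blast
  have T_gt: "2 < p" "\<And>r. r \<in> S \<Longrightarrow> r < p" if "p \<in> T" for p
    using T(3)[OF that] S(1) by auto
  obtain K1 where K1: "K1 > 0" and facU: "\<And>n. n \<ge> 1 \<Longrightarrow> \<Prod>S dvd n \<Longrightarrow>
    \<exists>l l'. l > 0 \<and> l' > 0 \<and> U n = l * l' \<and>
      real l \<le> K1 * g powr (real n * (1 / 2 + \<eta>)) \<and> real l' \<le> K1 * g powr (real n * (1 / 2 + \<eta>))"
    using strong_divisibility_growth.balanced_factorization[OF U S(1,2) S(4,5)] \<eta> by auto
  obtain K2 where K2: "K2 > 0" and facW: "\<And>n. n \<ge> 1 \<Longrightarrow> odd n \<Longrightarrow> \<Prod>T dvd n \<Longrightarrow>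
    \<exists>l l'. l > 0 \<and> l' > 0 \<and> W n = l * l' \<and>
      real l \<le> K2 * g powr (real n * (1 / 2 + \<eta>)) \<and> real l' \<le> K2 * g powr (real n * (1 / 2 + \<eta>))"
    using strong_divisibility_growth.balanced_factorization[OF W T(1,2) T(4,5)] \<eta> by auto
  \<comment> \<open>The extra power of \<open>g\<close> converts the bound in terms of
    \<open>k' = k + a\<close> into one in terms of \<open>k\<close>.\<close>
  define K3 where "K3 = max K1 (K2 * g powr (real_of_int a * (1 / 2 + \<eta>)))"
  have K3: "K3 > 0" using K1 by (simp add: K3_def)
  define B where "B = 36 * (\<alpha> * (real q)\<^sup>2 + (real p)\<^sup>2) * K3\<^sup>2"
  have B: "B > 0" unfolding B_def using \<alpha> pq K3 by (intro mult_pos_pos add_pos_pos) auto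
  \<comment> \<open>The summands account for the three parts of \<open>N\<close> below: the count
    bound, its rounding up, and \<open>k\<close>, estimated by the Bernoulli inequality.\<close>
  define E where "E = B / sqrt \<alpha> + 1 + 1 / (g - 1)"
  have E: "E > 0" unfolding E_def using B \<alpha> g by (intro add_pos_pos) auto
  define C where "C = 12 * real p * K / E powr (-1 + \<epsilon>')"
  have C: "C > 0" unfolding C_def using pq K E by simp
  have gap: "\<exists>N\<ge>k. N \<ge> 2 \<and> delta_min \<alpha> N \<le> C * real N powr (-1 + \<epsilon>)"
    if k: "k \<ge> 1" "k' \<ge> 1" "int k' = int k + a" "\<Prod>S dvd k" "\<Prod>T dvd k'" "odd k'" for k k'
  proof -
    define Y where "Y = K3 * g powr (real k * (1 / 2 + \<eta>))"
    define X where "X = B * g powr (real k * (1 + 2 * \<eta>))"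
    have rk': "real k' = real k + real_of_int a"
      using k(3) by (metis of_int_add of_int_of_nat_eq)
    have Y1: "K1 * g powr (real k * (1 / 2 + \<eta>)) \<le> Y"
      unfolding Y_def K3_def by (intro mult_right_mono) auto
    have "K2 * g powr (real k' * (1 / 2 + \<eta>))
        = K2 * g powr (real_of_int a * (1 / 2 + \<eta>)) * g powr (real k * (1 / 2 + \<eta>))"
      unfolding rk' by (simp add: distrib_right powr_add)
    also have "\<dots> \<le> Y" unfolding Y_def K3_def by (intro mult_right_mono) auto
    finally have Y2: "K2 * g powr (real k' * (1 / 2 + \<eta>)) \<le> Y" .
    have small: "real m \<le> 6 * real c * Y"
      if "m \<le> 3 * c * (l + l')" "real l \<le> Y" "real l' \<le> Y" for m c l l' :: nat
    proof -
      have "real m \<le> real (3 * c * (l + l'))" using that(1) by (rule of_nat_mono)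
      also have "\<dots> = 3 * real c * (real l + real l')" by simp
      also have "\<dots> \<le> 3 * real c * (Y + Y)" using that by (intro mult_left_mono add_mono) auto
      finally show ?thesis by simp
    qed
    obtain l l' where l: "l > 0" "l' > 0" "U k = l * l'" "real l \<le> Y" "real l' \<le> Y"
      using facU[OF k(1,4)] Y1 by (meson order_trans)
    obtain h h' where h: "h > 0" "h' > 0" "W k' = h * h'" "real h \<le> Y" "real h' \<le> Y"
      using facW[OF k(2,6,5)] Y2 by (meson order_trans)
    obtain m m' where m: "m \<ge> 1" "m' \<ge> 1" "m' \<le> m" "m \<le> 3 * q * (l + l')"
      and m_eq: "(real m)\<^sup>2 - (real m')\<^sup>2 = 12 * real q * real l * real l'"
      using diff_squares_factorization[OF pq(2) l(1,2)] by blast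
    obtain n n' where n: "n \<ge> 1" "n' \<ge> 1" "n' \<le> n" "n \<le> 3 * p * (h + h')"
      and n_eq: "(real n)\<^sup>2 - (real n')\<^sup>2 = 12 * real p * real h * real h'"
      using diff_squares_factorization[OF pq(1) h(1,2)] by blast
    \<comment> \<open>Large and small squares are paired crosswise, so that \<open>y - z\<close> is
      \<open>\<alpha>\<close> times one difference of squares minus the other.\<close>
    define y z where "y = \<alpha> * (real m)\<^sup>2 + (real n')\<^sup>2" and "z = \<alpha> * (real m')\<^sup>2 + (real n)\<^sup>2"
    have spec: "y \<in> spec_set \<alpha>" "z \<in> spec_set \<alpha>"
      using m n unfolding spec_set_def y_def z_def by blast+
    have diff: "y - z = \<alpha> * (12 * real q * real (U k)) - 12 * real p * real (W k')"
    proof -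
      have "y - z = \<alpha> * ((real m)\<^sup>2 - (real m')\<^sup>2) - ((real n)\<^sup>2 - (real n')\<^sup>2)"
        by (simp add: y_def z_def algebra_simps)
      then show ?thesis unfolding m_eq n_eq l(3) h(3) by simp
    qed
    have "y \<noteq> z"
    proof
      assume "y = z"
      then have "\<alpha> = 12 * real p * real (W k') / (12 * real q * real (U k))"
        using diff l pq by (simp add: field_simps)
      also have "\<dots> \<in> \<rat>" by (intro Rats_divide Rats_mult) auto
      finally show False using \<alpha> by simp
    qed
    have "\<bar>y - z\<bar> \<le> 12 * real p * (K * (1 / g ^ k))"
    proof -
      have "y - z = - (12 * real p * (real (W k') - \<beta> * real (U k)))"
        unfolding diff \<alpha>(1) using pq by (simp add: field_simps)
      then have "\<bar>y - z\<bar> = 12 * real p * \<bar>real (W k') - \<beta> * real (U k)\<bar>"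
        by (simp add: abs_mult)
      also have "\<dots> \<le> 12 * real p * (K * (1 / g ^ k))"
        using approx[OF k(3)] by (rule mult_left_mono) simp
      finally show ?thesis .
    qed
    have X0: "X \<ge> 0" using B by (simp add: X_def)
    have "\<alpha> * (real m)\<^sup>2 + (real n)\<^sup>2 \<le> X"
    proof -
      have "\<alpha> * (real m)\<^sup>2 + (real n)\<^sup>2 \<le> \<alpha> * (6 * real q * Y)\<^sup>2 + (6 * real p * Y)\<^sup>2"
        using small[OF m(4) l(4,5)] small[OF n(4) h(4,5)] \<alpha>
        by (intro add_mono mult_left_mono power_mono) auto
      also have "\<dots> = 36 * (\<alpha> * (real q)\<^sup>2 + (real p)\<^sup>2) * Y\<^sup>2"
        by (simp add: power_mult_distrib algebra_simps)
      also have "Y\<^sup>2 = K3\<^sup>2 * g powr (real k * (1 + 2 * \<eta>))"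
        unfolding Y_def power_mult_distrib using g
        by (simp add: power2_eq_square powr_add[symmetric] algebra_simps)
      finally show ?thesis by (simp add: X_def B_def mult.assoc)
    qed
    moreover have "(real m')\<^sup>2 \<le> (real m)\<^sup>2" "(real n')\<^sup>2 \<le> (real n)\<^sup>2"
      using m n by (auto intro!: power_mono)
    ultimately have yX: "y \<le> X" and zX: "z \<le> X"
      using \<alpha>(2) mult_left_mono[of "(real m')\<^sup>2" "(real m)\<^sup>2" \<alpha>] unfolding y_def z_def by linarith+
    \<comment> \<open>Adding \<open>k\<close> guarantees \<open>N \<ge> k\<close>, so unbounded
      \<open>k\<close> gives infinitely many \<open>N\<close>.\<close>
    define N where "N = nat \<lceil>X / sqrt \<alpha>\<rceil> + k"
    have "X / sqrt \<alpha> \<ge> 0" using X0 \<alpha> by simp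
    have "real (card {w \<in> spec_set \<alpha>. w \<le> X}) \<le> X / sqrt \<alpha>"
      using spec_set_le_bound(2)[OF \<alpha>(2) X0] .
    also have "\<dots> \<le> real N" unfolding N_def by (simp add: le_nat_iff) linarith
    finally have card: "card {w \<in> spec_set \<alpha>. w \<le> X} \<le> N" by simp
    have dm: "delta_min \<alpha> N \<le> \<bar>y - z\<bar>" "N \<ge> 2"
      using delta_min_le[OF \<alpha>(2) spec(1,2) _ zX card] delta_min_le[OF \<alpha>(2) spec(2,1) _ yX card] \<open>y \<noteq> z\<close>
      by (cases y z rule: linorder_cases; simp)+
    have "real N \<le> E * g powr (real k * (1 + 2 * \<eta>))"
    proof -
      let ?G = "g powr (real k * (1 + 2 * \<eta>))"
      have "g ^ k = g powr real k" using g by (simp add: powr_realpow)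
      also have "\<dots> \<le> ?G"
        using g \<eta> by (intro powr_mono) (auto simp: mult_le_cancel_left1)
      finally have gk: "g ^ k \<le> ?G" .
      have "1 + real k * (g - 1) \<le> (1 + (g - 1)) ^ k"
        using g by (intro Bernoulli_inequality) auto
      then have "real k * (g - 1) \<le> ?G" using gk by simp
      then have "real k \<le> 1 / (g - 1) * ?G" using g by (simp add: field_simps)
      moreover have "1 \<le> ?G" using gk g one_le_power[of g k] by linarith
      moreover have "real (nat \<lceil>X / sqrt \<alpha>\<rceil>) \<le> X / sqrt \<alpha> + 1"
        using \<open>X / sqrt \<alpha> \<ge> 0\<close> by linarith
      moreover have "X / sqrt \<alpha> = B / sqrt \<alpha> * ?G" by (simp add: X_def)
      ultimately show ?thesis unfolding N_def E_def distrib_right of_nat_add by linarith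
    qed
    have N1: "real N \<ge> 1" using dm by simp
    have "12 * real p * (K * (1 / g ^ k)) = C * (E powr (-1 + \<epsilon>') * g powr (- real k))"
      using E g by (simp add: C_def powr_minus powr_realpow field_simps)
    also have "\<dots> \<le> C * (E powr (-1 + \<epsilon>') * g powr (real k * (1 + 2 * \<eta>) * (-1 + \<epsilon>')))"
    proof -
      have "(1 + 2 * \<eta>) * (-1 + \<epsilon>') = -1 + \<epsilon>' / 2 + \<epsilon>' * \<epsilon>' / 2"
        by (simp add: \<eta>_def field_simps)
      also have "\<dots> \<ge> -1" using \<epsilon>' by simp
      finally have "real k * (-1) \<le> real k * ((1 + 2 * \<eta>) * (-1 + \<epsilon>'))"
        by (intro mult_left_mono) auto
      then show ?thesis
        using C g by (intro mult_left_mono powr_mono) (auto simp: mult.assoc)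
    qed
    also have "\<dots> = C * (E * g powr (real k * (1 + 2 * \<eta>))) powr (-1 + \<epsilon>')"
      using E by (simp add: powr_mult powr_powr)
    also have "\<dots> \<le> C * real N powr (-1 + \<epsilon>')"
      using \<open>real N \<le> E * _\<close> N1 \<epsilon>' C by (intro mult_left_mono powr_mono2') auto
    also have "\<dots> \<le> C * real N powr (-1 + \<epsilon>)"
      using C N1 \<epsilon>' by (intro mult_left_mono powr_mono) auto
    finally have "delta_min \<alpha> N \<le> C * real N powr (-1 + \<epsilon>)"
      using dm(1) \<open>\<bar>y - z\<bar> \<le> _\<close> by linarith
    then show ?thesis using dm(2) by (intro exI[of _ N]) (simp add: N_def)
  qed
  have oddT: "odd (\<Prod>T)"
    using T(1,2) T_gt(1) prime_odd_nat by (auto simp: even_prod_iff)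
  have oddS: "odd (\<Prod>S)"
    using S(1-3) prime_odd_nat by (auto simp: even_prod_iff)
  have "coprime (\<Prod>S) (2 * \<Prod>T)"
  proof -
    have "coprime (\<Prod>S) (\<Prod>T)"
    proof (intro prod_coprime_left prod_coprime_right)
      fix r p assume "r \<in> S" "p \<in> T"
      then show "coprime r p"
        using S(2) T(2) T_gt(2)[of p r] by (intro primes_coprime) auto
    qed
    then show ?thesis using oddS by simp
  qed
  then have cop: "coprime (int (\<Prod>S)) (int (2 * \<Prod>T))" by (simp only: coprime_int_iff)
  have ex_k: "\<exists>k k'. k \<ge> b \<and> k \<ge> 1 \<and> k' \<ge> 1 \<and> int k' = int k + a \<and> \<Prod>S dvd k \<and> \<Prod>T dvd k' \<and> odd k'" for b :: nat
  proof -
    \<comment> \<open>The second congruence says that \<open>k0 + a\<close> is an odd multiple of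
      the product of \<open>T\<close>, hence odd itself.\<close>
    obtain k0 where k0: "[k0 = 0] (mod int (\<Prod>S))" "[k0 = int (\<Prod>T) - a] (mod int (2 * \<Prod>T))"
      using binary_chinese_remainder_int[OF cop] by blast
    define R where "R = int (\<Prod>S) * int (2 * \<Prod>T)"
    have "\<Prod>S > 0" "\<Prod>T > 0" using oddS oddT by (auto intro: odd_pos)
    then have R: "R \<ge> 1" unfolding R_def int_one_le_iff_zero_less by (intro mult_pos_pos) (simp_all only: of_nat_0_less_iff)
    \<comment> \<open>Large enough that adding \<open>t\<close> periods makes both indices positive
      and the first one at least \<open>b\<close>.\<close>
    define t where "t = \<bar>k0\<bar> + \<bar>a\<bar> + int b + 1"
    define k1 where "k1 = k0 + R * t"
    have "1 * t \<le> R * t" using R by (intro mult_right_mono) (auto simp: t_def)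
    then have "\<bar>k0\<bar> + \<bar>a\<bar> + int b + 1 \<le> R * t" by (simp add: t_def)
    then have k1: "k1 \<ge> int b" "k1 \<ge> 1" "k1 + a \<ge> 1" unfolding k1_def by linarith+
    have dS: "int (\<Prod>S) dvd k1"
      using k0(1) unfolding k1_def R_def by (simp add: cong_0_iff)
    have "int (2 * \<Prod>T) dvd k0 - (int (\<Prod>T) - a)" using k0(2) by (simp only: cong_iff_dvd_diff)
    then have "int (2 * \<Prod>T) dvd (k0 - (int (\<Prod>T) - a)) + R * t"
      unfolding R_def by (intro dvd_add) auto
    then obtain j where "(k0 - (int (\<Prod>T) - a)) + R * t = int (2 * \<Prod>T) * j"
      by (rule dvdE)
    then have j: "k1 + a = int (\<Prod>T) * (2 * j + 1)" by (simp add: k1_def algebra_simps)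
    show ?thesis
    proof (intro exI conjI)
      show "nat k1 \<ge> b" "nat k1 \<ge> 1" "nat (k1 + a) \<ge> 1" "int (nat (k1 + a)) = int (nat k1) + a"
        using k1 by auto
      show "\<Prod>S dvd nat k1" using dS k1 by (metis int_dvd_int_iff int_nat_eq order_trans zero_le_one)
      have e: "int (nat (k1 + a)) = int (\<Prod>T) * (2 * j + 1)" using j k1 by simp
      then show "\<Prod>T dvd nat (k1 + a)" by (metis dvd_triv_left int_dvd_int_iff)
      have "odd (int (nat (k1 + a)))" unfolding e using oddT by (simp del: of_nat_prod)
      then show "odd (nat (k1 + a))" by (metis even_of_nat)
    qed
  qed
  have "infinite {N :: nat. N \<ge> 2 \<and> delta_min \<alpha> N \<le> C * real N powr (-1 + \<epsilon>)}"
    unfolding infinite_nat_iff_unbounded_le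
  proof
    fix b :: nat
    obtain k k' where k: "k \<ge> b" "k \<ge> 1" "k' \<ge> 1" "int k' = int k + a" "\<Prod>S dvd k" "\<Prod>T dvd k'" "odd k'"
      using ex_k by blast
    from gap[OF k(2-7)] k(1)
    show "\<exists>N\<ge>b. N \<in> {N. N \<ge> 2 \<and> delta_min \<alpha> N \<le> C * real N powr (-1 + \<epsilon>)}"
      by (auto intro: order_trans)
  qed
  with C show ?thesis by blast
qed

section \<open>Lucas sequences as strong divisibility sequences, and the theorem\<close>

context lucas
begin

text \<open>\<open>J\<close> stays general because \<open>U\<close> is needed with all indices in
  the role of \<open>U\<close> and, for \<open>b = 0\<close>, with odd indices in the role of
  \<open>W\<close>.\<close>

lemma strong_divisibility_growth_U:
  assumes "\<And>d n. J n \<Longrightarrow> d dvd n \<Longrightarrow> J d"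
  shows "strong_divisibility_growth (\<lambda>n. nat (U n)) J \<omega> ((1 - 1 / \<omega>\<^sup>2) / (\<omega> - \<omega>')) (2 / (\<omega> - \<omega>'))"
proof
  fix m n
  have "int (gcd (nat (U m)) (nat (U n))) = int (nat (U (gcd m n)))"
    using U_nonneg gcd_lucas_U[OF s U_nonneg, of m n] by (simp flip: gcd_int_int_eq)
  then show "gcd (nat (U m)) (nat (U n)) = nat (U (gcd m n))" by (simp only: of_nat_eq_iff)
qed (use assms U_bounds U_nonneg gt1 one_minus_pos diff_pos in auto)

lemma strong_divisibility_growth_V:
  "strong_divisibility_growth (\<lambda>n. nat (V n)) odd \<omega> (1 - 1 / \<omega>\<^sup>2) 2"
proof
  fix m n :: nat
  assume mn: "odd m" "odd n"
  then have "odd (gcd m n)" by simp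
  then have "int (gcd (nat (V m)) (nat (V n))) = int (nat (V (gcd m n)))"
    using mn V_pos[of m] V_pos[of n] V_pos[of "gcd m n"] odd_pos[of m] odd_pos[of n] gcd_V_odd[OF mn]
    by (simp add: Suc_le_eq flip: gcd_int_int_eq)
  then show "gcd (nat (V m)) (nat (V n)) = nat (V (gcd m n))" by (simp only: of_nat_eq_iff)
next
  fix n :: nat assume "n \<ge> 1"
  then show "(1 - 1 / \<omega>\<^sup>2) * \<omega> ^ n \<le> real (nat (V n))" "real (nat (V n)) \<le> 2 * \<omega> ^ n"
    using V_bounds[of n] V_pos[of n] by auto
qed (use gt1 one_minus_pos in \<open>auto elim: dvd_trans\<close>)

end

theorem theorem6p1:
  fixes a :: int and b :: nat and x :: int and \<sigma> :: int and r :: rat and \<alpha> :: real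
  assumes "b \<in> {0, 1}"
    and "x \<noteq> 0"
    and "\<sigma> \<in> {1, -1}"
    and "r \<noteq> 0"
    and "real_of_int (x^2 + 4 * \<sigma>) \<ge> 0"
    and "\<alpha> = of_rat r * ((real_of_int x + sqrt (real_of_int (x^2 + 4 * \<sigma>))) / 2) powi a
                 * (sqrt (real_of_int (x^2 + 4 * \<sigma>))) ^ b"
    and "\<alpha> > 0"
    and "\<alpha> \<notin> \<rat>"
    and "\<exists>p q s :: int. p \<noteq> 0 \<and> of_int p * \<alpha>^2 + of_int q * \<alpha> + of_int s = 0"
  shows "\<forall>\<epsilon>>0. \<exists>C>0. infinite {N :: nat. N \<ge> 2 \<and>
           delta_min \<alpha> N \<le> C * real N powr (-1 + \<epsilon>)}"
proof -
  define D where "D = x\<^sup>2 + 4 * \<sigma>"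
  define d where "d = sqrt (real_of_int D)"
  have \<alpha>_eq: "\<alpha> = of_rat r * ((real_of_int x + d) / 2) powi a * d ^ b"
    using assms(6) by (simp add: d_def D_def)
  \<comment> \<open>The discriminant vanishes for \<open>x = 2\<close>,
    \<open>\<sigma> = -1\<close>, for example; irrationality of \<open>\<alpha>\<close> excludes
    this.\<close>
  have "d \<noteq> 0"
  proof
    assume "d = 0"
    then have "\<alpha> \<in> \<rat>" unfolding \<alpha>_eq
      by (cases "a \<ge> 0") (auto simp: power_int_def intro!: Rats_mult Rats_power Rats_inverse Rats_divide)
    with assms(8) show False by simp
  qed
  moreover have "d \<ge> 0" using assms(5) by (simp add: d_def D_def)
  ultimately have "d > 0" by simp
  then have D: "D > 0" by (simp add: d_def)
  have d_sq: "d * d = real_of_int D" using D by (simp add: d_def)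
  define \<omega> \<omega>' where "\<omega> = (\<bar>real_of_int x\<bar> + d) / 2" and "\<omega>' = (\<bar>real_of_int x\<bar> - d) / 2"
  have diff: "\<omega> - \<omega>' = d" by (simp add: \<omega>_def \<omega>'_def field_simps)
  have prod: "\<omega> * \<omega>' = - real_of_int \<sigma>"
  proof -
    have "\<omega> * \<omega>' = (\<bar>real_of_int x\<bar> * \<bar>real_of_int x\<bar> - d * d) / 4"
      by (simp add: \<omega>_def \<omega>'_def field_simps)
    then show ?thesis
      unfolding d_sq abs_mult_self_eq by (simp add: D_def power2_eq_square)
  qed
  have gt1: "\<omega> > 1"
  proof (cases "\<sigma> = 1")
    case True
    have "x\<^sup>2 \<ge> 0" by simp
    then have "real_of_int D \<ge> 2\<^sup>2" using True by (simp add: D_def)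
    then have "d \<ge> 2" unfolding d_def by (rule real_le_rsqrt)
    moreover have "\<bar>real_of_int x\<bar> \<ge> 1" using assms(2) by linarith
    ultimately show ?thesis by (simp add: \<omega>_def)
  next
    case False
    \<comment> \<open>Now \<open>\<sigma> = -1\<close>, so positivity of \<open>D\<close> means that
      \<open>x\<close> has absolute value above 2.\<close>
    then have "2\<^sup>2 < \<bar>x\<bar>\<^sup>2" using D assms(3) by (simp add: D_def)
    then have "2 < \<bar>x\<bar>" using power2_less_imp_less[of 2 "\<bar>x\<bar>"] by simp
    then have "2 < \<bar>real_of_int x\<bar>" by linarith
    then have "2 < \<bar>real_of_int x\<bar>" by linarith
    then show ?thesis using \<open>d > 0\<close> by (simp add: \<omega>_def)
  qed
  interpret lucas "\<bar>x\<bar>" \<sigma> \<omega> \<omega>'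
    using assms(3) prod gt1 by unfold_locales (auto simp: \<omega>_def \<omega>'_def field_simps)
  obtain a' where a': "\<bar>(real_of_int x + d) / 2\<bar> powi a = \<omega> powi a'"
  proof (cases "x > 0")
    case True
    then have "\<bar>(real_of_int x + d) / 2\<bar> = \<omega>" using \<open>d > 0\<close> by (simp add: \<omega>_def)
    then show ?thesis using that by simp
  next
    case False
    \<comment> \<open>For negative \<open>x\<close> the base is the conjugate up to sign, of
      absolute value \<open>1 / \<omega>\<close>, hence \<open>a' = - a\<close>.\<close>
    then have "(real_of_int x + d) / 2 = - \<omega>'" by (simp add: \<omega>'_def field_simps)
    then have "\<bar>(real_of_int x + d) / 2\<bar> = inverse \<omega>" using abs_conj by (simp add: inverse_eq_divide)
    then show ?thesis using that[of "- a"] by (simp add: power_int_inverse power_int_minus)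
  qed
  obtain p q :: nat where q: "q \<noteq> 0" and r: "\<bar>of_rat r\<bar> = real p / real q"
    using Rats_abs_nat_div_natE[of "of_rat r :: real"] by (metis Rats_of_rat)
  have "p \<noteq> 0" using r assms(4) by (intro notI) simp
  \<comment> \<open>Positivity of \<open>\<alpha>\<close> allows the signs of \<open>r\<close> and
    of the base to be dropped together.\<close>
  have "\<alpha> = \<bar>\<alpha>\<bar>" using assms(7) by simp
  also have "\<dots> = real p / real q * (\<omega> powi a' * d ^ b)"
    unfolding \<alpha>_eq abs_mult r power_int_abs a' using \<open>d > 0\<close> by simp
  finally have \<alpha>: "\<alpha> = real p / real q * (\<omega> powi a' * d ^ b)" .
  have pos: "\<omega> powi a' + \<omega> powi (- a') > 0" using gt1 by (intro add_pos_pos) auto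
  show ?thesis
  proof (intro allI impI)
    fix \<epsilon> :: real assume \<epsilon>: "\<epsilon> > 0"
    consider "b = 0" | "b = 1" using assms(1) by auto
    then show "\<exists>C>0. infinite {N :: nat. N \<ge> 2 \<and> delta_min \<alpha> N \<le> C * real N powr (-1 + \<epsilon>)}"
    proof cases
      case 1
      show ?thesis
      proof (rule infinitely_many_small_gaps)
        show "strong_divisibility_growth (\<lambda>n. nat (U n)) (\<lambda>_. True) \<omega>
            ((1 - 1 / \<omega>\<^sup>2) / (\<omega> - \<omega>')) (2 / (\<omega> - \<omega>'))"
          by (rule strong_divisibility_growth_U) simp
        show "strong_divisibility_growth (\<lambda>n. nat (U n)) odd \<omega>
            ((1 - 1 / \<omega>\<^sup>2) / (\<omega> - \<omega>')) (2 / (\<omega> - \<omega>'))"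
          by (rule strong_divisibility_growth_U) (auto elim: dvd_trans)
        show "\<bar>real (nat (U k')) - \<omega> powi a' * real (nat (U k))\<bar>
            \<le> (\<omega> powi a' + \<omega> powi (- a')) / (\<omega> - \<omega>') * (1 / \<omega> ^ k)"
          if "int k' = int k + a'" for k k'
          using U_approx[OF that] U_nonneg by simp
        show "\<alpha> = real p / real q * (\<omega> powi a')" using \<alpha> 1 by simp
      qed (use \<epsilon> assms(7,8) \<open>p \<noteq> 0\<close> q pos diff_pos in auto)
    next
      case 2
      show ?thesis
      proof (rule infinitely_many_small_gaps)
        show "strong_divisibility_growth (\<lambda>n. nat (U n)) (\<lambda>_. True) \<omega>
            ((1 - 1 / \<omega>\<^sup>2) / (\<omega> - \<omega>')) (2 / (\<omega> - \<omega>'))"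
          by (rule strong_divisibility_growth_U) simp
        show "strong_divisibility_growth (\<lambda>n. nat (V n)) odd \<omega> (1 - 1 / \<omega>\<^sup>2) 2"
          by (rule strong_divisibility_growth_V)
        show "\<bar>real (nat (V k')) - \<omega> powi a' * d * real (nat (U k))\<bar>
            \<le> (\<omega> powi a' + \<omega> powi (- a')) * (1 / \<omega> ^ k)"
          if "int k' = int k + a'" for k k'
        proof -
          have "V k' \<ge> 0" using V_pos[of k'] by (cases "k' = 0") auto
          then show ?thesis using V_approx[OF that] U_nonneg by (simp add: diff)
        qed
        show "\<alpha> = real p / real q * (\<omega> powi a' * d)" using \<alpha> 2 by simp
      qed (use \<epsilon> assms(7,8) \<open>p \<noteq> 0\<close> q pos in auto)
    qed
  qed
qed

end
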